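(* For every nonnegative integer $n$, there is a bijection between the set of partitions of $n$ with designated summands and the set of pairs $(\alpha,\beta)$ of partitions with $|\alpha|+|\beta|=n$, where $\alpha$ is an arbitrary ordinary partition and $\beta$ is a partition all of whose parts are $\not\equiv \pm1 \pmod 6$.
   Context: A partition of $n$ with designated summands is an ordinary partition of $n$ in which, for each part size that occurs, exactly one of the parts of that size is designated; if a size $t$ occurs $m_t$ times, the copies are regarded as ordered and the designation may be placed on any one of the $m_t$ positions, different positions giving different objects (e.g. $2'+2$ and $2+2'$ are distinct). $|\alpha|$ denotes the sum of parts of $\alpha$; the empty partition is allowed. *)

theory Defs
  imports "HOL-Library.Multiset" "HOL-Library.FuncSet" "HOL-Number_Theory.Cong"
begin

definition partitions_of :: "nat \<Rightarrow> nat multiset set" where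
  "partitions_of n = {M. 0 \<notin># M \<and> sum_mset M = n}"

text \<open>
  A partition with designated summands is a pair \<open>(M, d)\<close>: the underlying partition \<open>M\<close> and,
  for each part size \<open>t\<close> of \<open>M\<close>, the position \<open>d t\<close> of the designated copy among the
  \<open>count M t\<close> ordered copies of \<open>t\<close>. Extensionality (\<open>PiE\<close>) fixes \<open>d\<close> outside the parts of \<open>M\<close>,
  so that distinct pairs are distinct objects. For example, \<open>2' + 2\<close> and \<open>2 + 2'\<close> share
  \<open>M = {#2, 2#}\<close> and have \<open>d 2 = 1\<close> and \<open>d 2 = 2\<close> respectively.
\<close>

definition designated_partitions_of :: "nat \<Rightarrow> (nat multiset \<times> (nat \<Rightarrow> nat)) set" where
  "designated_partitions_of n =
     (SIGMA M : partitions_of n. PiE (set_mset M) (\<lambda>t. {1..count M t}))"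

definition partition_pairs_of :: "nat \<Rightarrow> (nat multiset \<times> nat multiset) set" where
  "partition_pairs_of n =
     {(\<alpha>, \<beta>). \<exists>a b. a + b = n \<and> \<alpha> \<in> partitions_of a \<and> \<beta> \<in> partitions_of b \<and>
        (\<forall>k \<in># \<beta>. \<not> [int k = 1] (mod 6) \<and> \<not> [int k = - 1] (mod 6))}"

end

theory Submission
  imports Defs "HOL-Library.Nat_Bijection"
begin

text \<open>
  For a part size with \<open>x = q ^ t\<close>, designated summands contribute
  \<open>1 + x / (1 - x)\<^sup>2 = 1 / (1 - x) * ((1 + x ^ 3) / (1 - x ^ 2))\<close>, and the second factor is the sum
  of all \<open>x ^ c\<close> with \<open>c \<noteq> 1\<close>. The first factor yields \<open>\<alpha>\<close>. A partition with no multiplicity 1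
  is three copies of a partition into distinct parts together with two copies of an arbitrary
  partition; replacing the distinct parts by odd parts (Euler) and scaling part sizes by 3 and 2
  instead of repeating them yields odd multiples of 3 and even numbers, which are the parts of \<open>\<beta>\<close>.
\<close>

section \<open>Weight-preserving bijections\<close>

text \<open>The bijective form of an equality of generating functions. Treating all sizes at once
  lets factors be replaced independently; \<open>weight_equiv_level\<close> returns to a fixed
  n.\<close>

definition weight_equiv :: "'a set \<Rightarrow> ('a \<Rightarrow> nat) \<Rightarrow> 'b set \<Rightarrow> ('b \<Rightarrow> nat) \<Rightarrow> bool" where
  "weight_equiv A w B v \<longleftrightarrow> (\<exists>f. bij_betw f A B \<and> (\<forall>x\<in>A. v (f x) = w x))"

lemma weight_equivI:
  assumes "bij_betw f A B" "\<And>x. x \<in> A \<Longrightarrow> v (f x) = w x"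
  shows "weight_equiv A w B v"
  using assms unfolding weight_equiv_def by blast

lemma weight_equiv_refl: "weight_equiv A w A w"
  by (rule weight_equivI[of id]) auto

lemma weight_equiv_sym:
  assumes "weight_equiv A w B v"
  shows "weight_equiv B v A w"
proof -
  obtain f where f: "bij_betw f A B" "\<forall>x\<in>A. v (f x) = w x"
    using assms unfolding weight_equiv_def by blast
  show ?thesis
  proof (rule weight_equivI[OF bij_betw_inv_into[OF f(1)]])
    fix y assume "y \<in> B"
    then have "inv_into A f y \<in> A" "f (inv_into A f y) = y"
      using f(1) by (auto simp: bij_betw_def inv_into_into f_inv_into_f)
    then show "w (inv_into A f y) = v y"
      using f(2) by metis
  qed
qed

lemma weight_equiv_trans:
  assumes "weight_equiv A w B v" "weight_equiv B v C u"
  shows "weight_equiv A w C u"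
proof -
  obtain f where f: "bij_betw f A B" "\<forall>x\<in>A. v (f x) = w x"
    using assms unfolding weight_equiv_def by blast
  obtain g where g: "bij_betw g B C" "\<forall>x\<in>B. u (g x) = v x"
    using assms unfolding weight_equiv_def by blast
  show ?thesis
    by (rule weight_equivI[OF bij_betw_trans[OF f(1) g(1)]])
       (use f g bij_betwE in fastforce)
qed

text \<open>The coefficients p and q cover the weights 3 and 2 that arise from repeating or scaling
  parts.\<close>

lemma weight_equiv_times:
  assumes "weight_equiv A w B v" "weight_equiv C w' D v'"
  shows "weight_equiv (A \<times> C) (\<lambda>(x, y). p * w x + q * w' y) (B \<times> D) (\<lambda>(x, y). p * v x + q * v' y)"
proof -
  obtain f where f: "bij_betw f A B" "\<forall>x\<in>A. v (f x) = w x"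
    using assms unfolding weight_equiv_def by blast
  obtain g where g: "bij_betw g C D" "\<forall>x\<in>C. v' (g x) = w' x"
    using assms unfolding weight_equiv_def by blast
  have "bij_betw (map_prod f g) (A \<times> C) (B \<times> D)"
    using f(1) g(1) by (auto simp: bij_betw_def map_prod_inj_on map_prod_surj_on)
  then show ?thesis
    by (rule weight_equivI) (use f(2) g(2) in auto)
qed

lemma weight_equiv_level:
  assumes "weight_equiv A w B v"
  shows "\<exists>f. bij_betw f {x \<in> A. w x = n} {y \<in> B. v y = n}"
proof -
  obtain f where f: "bij_betw f A B" "\<forall>x\<in>A. v (f x) = w x"
    using assms unfolding weight_equiv_def by blast
  then have "bij_betw f {x \<in> A. w x = n} {y \<in> B. v y = n}"
    by (auto simp: bij_betw_def inj_on_def)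
  then show ?thesis by blast
qed

section \<open>Multiplicities and sums of multisets\<close>

lemma count_sum_replicate_mset:
  assumes "finite A"
  shows "count (\<Sum>t\<in>A. replicate_mset (h t) t) s = (if s \<in> A then h s else 0)"
  using assms by (simp add: count_sum sum.delta if_distrib cong: if_cong)

lemma sum_mset_repeat_mset: "sum_mset (repeat_mset k M) = k * sum_mset (M :: nat multiset)"
  by (induction k) auto

lemma sum_mset_nat_multiplicity:
  "sum_mset (M :: nat multiset) = (\<Sum>k\<in>set_mset M. count M k * k)"
proof -
  \<comment> \<open>\<open>fold_mset\<close> applies the step for x as often as x occurs; for
    addition this iterate adds the multiple at once.\<close>
  have "((+) x ^^ n) = (+) (n * x)" for x n :: nat
    by (induction n) auto
  then show ?thesis
    by (simp add: sum_mset.eq_fold sum.eq_fold fold_mset_def comp_def)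
qed

section \<open>Classes of partitions of arbitrary size\<close>

definition pos_msets :: "nat multiset set" where
  "pos_msets = {M. 0 \<notin># M}"

definition odd_msets :: "nat multiset set" where
  "odd_msets = {M. \<forall>k\<in>#M. odd k}"

text \<open>Partitions into distinct parts, encoded as sets.\<close>

definition pos_finite_sets :: "nat set set" where
  "pos_finite_sets = {D. finite D \<and> 0 \<notin> D}"

definition no_singleton_msets :: "nat multiset set" where
  "no_singleton_msets = {M \<in> pos_msets. \<forall>t. count M t \<noteq> 1}"

definition two_three_msets :: "nat multiset set" where
  "two_three_msets = {M \<in> pos_msets. \<forall>k\<in>#M. 2 dvd k \<or> 3 dvd k}"

definition designated_partitions :: "(nat multiset \<times> (nat \<Rightarrow> nat)) set" where
  "designated_partitions = (SIGMA M : pos_msets. PiE (set_mset M) (\<lambda>t. {1..count M t}))"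

section \<open>Separating the designations from the partition\<close>

text \<open>
  A part of multiplicity \<open>m\<close> with designated position \<open>d\<close> is split into \<open>m - d\<close> and \<open>d\<close> copies,
  except that \<open>d = 1\<close> puts all copies on the left; so the right multiplicity is never 1.
\<close>

lemma designated_equiv_pairs:
  "weight_equiv designated_partitions (\<lambda>(M, d). sum_mset M)
     (pos_msets \<times> no_singleton_msets) (\<lambda>(\<alpha>, \<gamma>). sum_mset \<alpha> + sum_mset \<gamma>)"
proof -
  define G :: "nat multiset \<Rightarrow> (nat \<Rightarrow> nat) \<Rightarrow> nat multiset" where
    "G M d = (\<Sum>t\<in>set_mset M. replicate_mset (if d t = 1 then 0 else d t) t)" for M d
  define f where "f = (\<lambda>(M, d). (M - G M d, G M d))"
  \<comment> \<open>A part absent from \<gamma> must have had position 1. The restriction provides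
    the extensionality demanded by \<open>PiE\<close>.\<close>
  define g :: "nat multiset \<times> nat multiset \<Rightarrow> nat multiset \<times> (nat \<Rightarrow> nat)" where
    "g = (\<lambda>(\<alpha>, \<gamma>). (\<alpha> + \<gamma>, \<lambda>t\<in>set_mset (\<alpha> + \<gamma>). if t \<in># \<gamma> then count \<gamma> t else 1))"
  have count_G: "count (G M d) t = (if t \<in># M \<and> d t \<noteq> 1 then d t else 0)" for M d t
    unfolding G_def by (simp add: count_sum_replicate_mset)
  have G_le: "G M d \<subseteq># M" if "(M, d) \<in> designated_partitions" for M d
    using that by (auto simp: designated_partitions_def subseteq_mset_def count_G PiE_iff)
  have G_in: "G M d \<in> no_singleton_msets" if "(M, d) \<in> designated_partitions" for M d
    using that G_le[OF that]
    by (auto simp: no_singleton_msets_def pos_msets_def designated_partitions_def count_G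
        dest: mset_subset_eqD)
  have "bij_betw f designated_partitions (pos_msets \<times> no_singleton_msets)"
  proof (rule bij_betw_byWitness[where f' = g])
    show "\<forall>x\<in>designated_partitions. g (f x) = x"
    proof safe
      fix M d assume Md: "(M, d) \<in> designated_partitions"
      have d: "d \<in> PiE (set_mset M) (\<lambda>t. {1..count M t})"
        using Md by (simp add: designated_partitions_def)
      have "(if t \<in># G M d then count (G M d) t else 1) = d t" if "t \<in># M" for t
      proof -
        \<comment> \<open>A position 0 would also leave t out of \<open>G M d\<close> and be read
          back as 1.\<close>
        have "d t \<ge> 1" using d that by (auto simp: PiE_iff)
        then show ?thesis using that by (auto simp: count_G not_in_iff simp flip: count_greater_zero_iff)
      qed
      then have "(\<lambda>t\<in>set_mset M. if t \<in># G M d then count (G M d) t else 1) = d"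
        using d by (intro extensionalityI[of _ "set_mset M"]) (auto simp: PiE_iff)
      then show "g (f (M, d)) = (M, d)"
        using G_le[OF Md] by (simp add: f_def g_def del: set_mset_union)
    qed
    show "\<forall>x\<in>pos_msets \<times> no_singleton_msets. f (g x) = x"
    proof safe
      fix \<alpha> \<gamma> assume "\<gamma> \<in> no_singleton_msets"
      then have "count \<gamma> t \<noteq> 1" for t
        by (auto simp: no_singleton_msets_def)
      \<comment> \<open>On parts of \<gamma> the recovered position is a multiplicity of at least 2,
        so the exceptional value 1 marks exactly the parts of \<alpha> absent from \<gamma>.\<close>
      then have "G (\<alpha> + \<gamma>) (\<lambda>t\<in>set_mset (\<alpha> + \<gamma>). if t \<in># \<gamma> then count \<gamma> t else 1) = \<gamma>"
        by (intro multiset_eqI) (auto simp: count_G not_in_iff)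
      then show "f (g (\<alpha>, \<gamma>)) = (\<alpha>, \<gamma>)"
        by (simp add: f_def g_def)
    qed
    show "f ` designated_partitions \<subseteq> pos_msets \<times> no_singleton_msets"
      using G_in by (auto simp: f_def designated_partitions_def pos_msets_def dest: in_diffD)
    show "g ` (pos_msets \<times> no_singleton_msets) \<subseteq> designated_partitions"
      by (auto simp: g_def designated_partitions_def no_singleton_msets_def pos_msets_def
          simp flip: count_greater_zero_iff)
  qed
  then show ?thesis
  proof (rule weight_equivI)
    fix x assume "x \<in> designated_partitions"
    then obtain M d where x: "x = (M, d)" "G M d \<subseteq># M"
      using G_le by (cases x) auto
    then show "(case f x of (\<alpha>, \<gamma>) \<Rightarrow> sum_mset \<alpha> + sum_mset \<gamma>) = (case x of (M, d) \<Rightarrow> sum_mset M)"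
      by (simp add: f_def flip: sum_mset.union)
  qed
qed

section \<open>Splitting partitions without multiplicity 1\<close>

text \<open>A number other than 1 is uniquely \<open>3 e + 2 i\<close> with \<open>e \<in> {0, 1}\<close>.\<close>

lemma no_singleton_equiv:
  "weight_equiv (pos_finite_sets \<times> pos_msets) (\<lambda>(D, E). 3 * \<Sum>D + 2 * sum_mset E)
     no_singleton_msets sum_mset"
proof -
  define f :: "nat set \<times> nat multiset \<Rightarrow> nat multiset" where
    "f = (\<lambda>(D, E). repeat_mset 3 (mset_set D) + repeat_mset 2 E)"
  \<comment> \<open>Parity forces \<open>e = c mod 2\<close>, and \<open>h c\<close> is the
    remaining i; truncated subtraction spoils this only for c = 1. Since \<open>h 0 = 0\<close>,
    \<open>count_g\<close> holds off the parts of M as well.\<close>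
  define h :: "nat \<Rightarrow> nat" where "h c = (c - 3 * (c mod 2)) div 2" for c
  define g :: "nat multiset \<Rightarrow> nat set \<times> nat multiset" where
    "g M = ({t. odd (count M t)}, \<Sum>t\<in>set_mset M. replicate_mset (h (count M t)) t)" for M
  have h: "3 * (c mod 2) + 2 * h c = c" if "c \<noteq> 1" for c
    using that unfolding h_def by (cases "even c") (auto elim!: evenE oddE)
  have odd_subset: "{t. odd (count M t)} \<subseteq> set_mset M" for M :: "nat multiset"
    by (auto simp: odd_pos simp flip: count_greater_zero_iff)
  then have fin: "finite {t. odd (count M t)}" for M :: "nat multiset"
    by (rule finite_subset) simp
  have count_g: "count (snd (g M)) t = h (count M t)" for M t
    by (simp add: g_def count_sum_replicate_mset not_in_iff h_def)
  have count_f: "count (f (D, E)) t = 3 * of_bool (t \<in> D) + 2 * count E t" if "finite D" for D E t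
    using that by (simp add: f_def count_mset_set')
  have "bij_betw f (pos_finite_sets \<times> pos_msets) no_singleton_msets"
  proof (rule bij_betw_byWitness[where f' = g])
    show "\<forall>x\<in>pos_finite_sets \<times> pos_msets. g (f x) = x"
    proof safe
      fix D E assume D: "D \<in> pos_finite_sets"
      then have [simp]: "finite D" by (simp add: pos_finite_sets_def)
      have "fst (g (f (D, E))) = D"
        by (auto simp: g_def count_f)
      moreover have "snd (g (f (D, E))) = E"
        by (intro multiset_eqI) (simp add: count_g count_f h_def)
      ultimately show "g (f (D, E)) = (D, E)"
        by (simp add: prod_eq_iff)
    qed
    show "\<forall>M\<in>no_singleton_msets. f (g M) = M"
    proof
      fix M assume "M \<in> no_singleton_msets"
      then have M: "count M t \<noteq> 1" for t by (simp add: no_singleton_msets_def)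
      show "f (g M) = M"
      proof (rule multiset_eqI)
        fix t
        have "count (f (g M)) t = 3 * of_bool (odd (count M t)) + 2 * h (count M t)"
          using count_f[of "fst (g M)" "snd (g M)" t] fin[of M] count_g[of M t]
          by (simp add: g_def)
        then show "count (f (g M)) t = count M t"
          using h[OF M, of t] by (simp add: odd_iff_mod_2_eq_one mod2_eq_if of_bool_def split: if_splits)
      qed
    qed
    show "f ` (pos_finite_sets \<times> pos_msets) \<subseteq> no_singleton_msets"
    proof safe
      fix D E assume "D \<in> pos_finite_sets" "E \<in> pos_msets"
      then have "finite D" "0 \<notin> D" "count E 0 = 0"
        by (auto simp: pos_finite_sets_def pos_msets_def not_in_iff)
      moreover have "3 * of_bool b + 2 * c \<noteq> (1 :: nat)" for b c
        by (cases b) presburger+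
      ultimately show "f (D, E) \<in> no_singleton_msets"
        by (simp add: no_singleton_msets_def pos_msets_def not_in_iff count_f del: One_nat_def)
    qed
    show "g ` no_singleton_msets \<subseteq> pos_finite_sets \<times> pos_msets"
    proof safe
      fix M D E assume "M \<in> no_singleton_msets" "(D, E) = g M"
      moreover from this have "count E 0 = h (count M 0)"
        using count_g[of M 0] by (metis snd_conv)
      ultimately show "D \<in> pos_finite_sets" "E \<in> pos_msets"
        using fin[of M]
        by (auto simp: g_def pos_finite_sets_def pos_msets_def no_singleton_msets_def not_in_iff h_def)
    qed
  qed
  then show ?thesis
    by (rule weight_equivI) (auto simp: f_def sum_mset_repeat_mset sum_unfold_sum_mset)
qed

section \<open>Odd parts and distinct parts\<close>

lemma odd_part_decomp:
  assumes "(d :: nat) > 0"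
  shows "\<exists>j k. d = 2 ^ j * k \<and> odd k"
  using assms
proof (induction d rule: less_induct)
  case (less d)
  show ?case
  proof (cases "even d")
    case True
    then obtain c where c: "d = 2 * c" ..
    obtain j k where "c = 2 ^ j * k" "odd k"
      using less.IH[of c] less.prems c by auto
    then show ?thesis
      by (intro exI[of _ "Suc j"] exI[of _ k]) (simp add: c)
  next
    case False
    then show ?thesis
      by (intro exI[of _ 0] exI[of _ d]) simp
  qed
qed

text \<open>Parity allows factors 2 to be cancelled only in pairs, one from each side. Together with
  \<open>odd_part_decomp\<close>, positive numbers correspond to pairs of an exponent and an odd
  number.\<close>

lemma pow2_mult_odd_inject:
  assumes "2 ^ i * a = 2 ^ j * (b :: nat)" "odd a" "odd b"
  shows "i = j \<and> a = b"
  using assms(1)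
proof (induction i arbitrary: j)
  case 0
  then show ?case using assms(2) by (cases j) auto
next
  case (Suc i)
  then show ?case using assms(3) by (cases j) auto
qed

text \<open>
  Glaisher's bijection: the binary expansion of the multiplicity of an odd part \<open>k\<close> tells which
  numbers \<open>2 ^ j * k\<close> occur among the distinct parts.
\<close>

lemma odd_equiv_distinct:
  "weight_equiv odd_msets sum_mset pos_finite_sets (\<Sum>)"
proof -
  define S where "S M = (SIGMA k : set_mset M. set_decode (count M k))" for M :: "nat multiset"
  define m :: "nat \<times> nat \<Rightarrow> nat" where "m = (\<lambda>(k, j). 2 ^ j * k)"
  define f where "f M = m ` S M" for M
  \<comment> \<open>The bound by \<open>\<Sum>D\<close> keeps the index set finite and loses
    nothing: if \<open>2 ^ j * k\<close> lies in D, then k is at most that element, hence at most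
    the sum.\<close>
  define g :: "nat set \<Rightarrow> nat multiset" where
    "g D = (\<Sum>k\<in>{k. odd k \<and> k \<le> \<Sum>D}. replicate_mset (set_encode {j. 2 ^ j * k \<in> D}) k)" for D
  have mem_f: "2 ^ j * k \<in> f M \<longleftrightarrow> j \<in> set_decode (count M k)"
    if "M \<in> odd_msets" "odd k" for M j k
  proof
    assume "2 ^ j * k \<in> f M"
    then obtain k' j' where "k' \<in># M" "j' \<in> set_decode (count M k')" "2 ^ j * k = 2 ^ j' * k'"
      by (auto simp: f_def S_def m_def)
    then show "j \<in> set_decode (count M k)"
      using that pow2_mult_odd_inject[of j k j' k'] by (auto simp: odd_msets_def)
  next
    assume *: "j \<in> set_decode (count M k)"
    then have "k \<in># M"
      by (metis not_in_iff set_decode_zero empty_iff)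
    with * show "2 ^ j * k \<in> f M"
      by (auto simp: f_def S_def m_def intro!: image_eqI[of _ _ "(k, j)"])
  qed
  have inj_m: "inj_on m (S M)" if "M \<in> odd_msets" for M
    using that by (auto simp: S_def m_def odd_msets_def intro!: inj_onI dest: pow2_mult_odd_inject)
  have count_g: "count (g D) k = (if odd k then set_encode {j. 2 ^ j * k \<in> D} else 0)"
    if "D \<in> pos_finite_sets" for D k
  proof -
    have "{j. 2 ^ j * k \<in> D} = {}" if "k > \<Sum>D"
    proof -
      have "2 ^ j * k \<notin> D" for j
      proof
        assume "2 ^ j * k \<in> D"
        then have "2 ^ j * k \<le> \<Sum>D"
          using \<open>D \<in> pos_finite_sets\<close> by (intro member_le_sum) (auto simp: pos_finite_sets_def)
        moreover have "k \<le> 2 ^ j * k" by simp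
        ultimately show False using that by linarith
      qed
      then show ?thesis by blast
    qed
    then show ?thesis
      by (auto simp: g_def count_sum_replicate_mset)
  qed
  \<comment> \<open>Decoding inverts \<open>set_encode\<close> only on finite sets; here j is mapped
    injectively into the finite set D.\<close>
  have fin: "finite {j. 2 ^ j * k \<in> D}" if "D \<in> pos_finite_sets" "odd k" for D and k :: nat
  proof -
    have "inj_on (\<lambda>j. 2 ^ j * k) {j. 2 ^ j * k \<in> D}"
      using that by (auto intro!: inj_onI dest: pow2_mult_odd_inject)
    moreover have "finite ((\<lambda>j. 2 ^ j * k) ` {j. 2 ^ j * k \<in> D})"
      using that by (rule_tac B = D in finite_subset) (auto simp: pos_finite_sets_def)
    ultimately show ?thesis by (rule finite_imageD[rotated])
  qed
  have g_in: "g D \<in> odd_msets" if "D \<in> pos_finite_sets" for D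
    by (auto simp: odd_msets_def count_g[OF that] simp flip: count_greater_zero_iff split: if_splits)
  have f_in: "f M \<in> pos_finite_sets" if "M \<in> odd_msets" for M
  proof -
    have "finite (f M)"
      unfolding f_def S_def by (intro finite_imageI finite_SigmaI) auto
    moreover have "0 \<notin> f M"
    proof
      assume "0 \<in> f M"
      then obtain k j where "k \<in># M" "2 ^ j * k = 0"
        unfolding f_def S_def m_def by force
      then have "0 \<in># M" by simp
      then show False
        using that by (auto simp: odd_msets_def)
    qed
    ultimately show ?thesis by (simp add: pos_finite_sets_def)
  qed
  have "bij_betw f odd_msets pos_finite_sets"
  proof (rule bij_betw_byWitness[where f' = g])
    show "\<forall>M\<in>odd_msets. g (f M) = M"
    proof
      fix M assume M: "M \<in> odd_msets"
      show "g (f M) = M"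
      proof (rule multiset_eqI)
        fix k
        show "count (g (f M)) k = count M k"
        proof (cases "odd k")
          case True
          then show ?thesis using M by (simp add: count_g f_in mem_f)
        next
          case False
          then have "k \<notin># M" using M by (auto simp: odd_msets_def)
          then show ?thesis using False M by (simp add: count_g f_in not_in_iff)
        qed
      qed
    qed
    show "\<forall>D\<in>pos_finite_sets. f (g D) = D"
    proof
      fix D assume D: "D \<in> pos_finite_sets"
      \<comment> \<open>Neither set contains 0, so by \<open>odd_part_decomp\<close> it suffices to
        compare membership of numbers in this form.\<close>
      have *: "2 ^ j * k \<in> f (g D) \<longleftrightarrow> 2 ^ j * k \<in> D" if "odd k" for j k
        using that by (simp add: mem_f[OF g_in[OF D] that] count_g[OF D] fin[OF D] set_encode_inverse)
      show "f (g D) = D"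
      proof (rule set_eqI)
        fix d
        show "d \<in> f (g D) \<longleftrightarrow> d \<in> D"
        proof (cases "d = 0")
          case True
          then show ?thesis using D f_in[OF g_in[OF D]] by (auto simp: pos_finite_sets_def)
        next
          case False
          then show ?thesis using * by (metis odd_part_decomp gr0I)
        qed
      qed
    qed
  qed (use f_in g_in in auto)
  then show ?thesis
  proof (rule weight_equivI)
    fix M :: "nat multiset" assume M: "M \<in> odd_msets"
    \<comment> \<open>Elements are grouped by their odd part k: the powers \<open>2 ^ j\<close> over
      the binary digits of the multiplicity add up to that multiplicity.\<close>
    have "\<Sum>(f M) = (\<Sum>(k, j)\<in>S M. 2 ^ j * k)"
      unfolding f_def using sum.reindex[OF inj_m[OF M], of id] by (simp add: m_def case_prod_unfold)
    also have "\<dots> = (\<Sum>k\<in>set_mset M. \<Sum>j\<in>set_decode (count M k). 2 ^ j * k)"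
      unfolding S_def by (rule sum.Sigma[symmetric]) auto
    also have "\<dots> = (\<Sum>k\<in>set_mset M. set_encode (set_decode (count M k)) * k)"
      unfolding set_encode_def by (simp add: sum_distrib_right)
    also have "\<dots> = sum_mset M"
      by (simp add: sum_mset_nat_multiplicity)
    finally show "\<Sum>(f M) = sum_mset M" .
  qed
qed

section \<open>Scaling parts by 3 and 2\<close>

text \<open>Parity tells the two sources apart: tripled odd parts are odd, doubled parts are even.
  Conversely, an odd part divisible by 2 or 3 is an odd multiple of 3; multiples of 6 belong to the
  doubled side.\<close>

lemma two_three_equiv:
  "weight_equiv (odd_msets \<times> pos_msets) (\<lambda>(M, E). 3 * sum_mset M + 2 * sum_mset E)
     two_three_msets sum_mset"
proof -
  define f :: "nat multiset \<times> nat multiset \<Rightarrow> nat multiset" where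
    "f = (\<lambda>(M, E). image_mset ((*) 3) M + image_mset ((*) 2) E)"
  define g :: "nat multiset \<Rightarrow> nat multiset \<times> nat multiset" where
    "g N = (image_mset (\<lambda>k. k div 3) (filter_mset odd N), image_mset (\<lambda>k. k div 2) (filter_mset even N))" for N
  have "bij_betw f (odd_msets \<times> pos_msets) two_three_msets"
  proof (rule bij_betw_byWitness[where f' = g])
    show "\<forall>x\<in>odd_msets \<times> pos_msets. g (f x) = x"
    proof safe
      fix M E assume M: "M \<in> odd_msets"
      have "filter_mset odd M = M" "filter_mset even M = {#}"
        using M by (auto simp: odd_msets_def filter_mset_eq_conv)
      then show "g (f (M, E)) = (M, E)"
        by (simp add: f_def g_def filter_mset_image_mset image_mset.compositionality comp_def)
    qed
    show "\<forall>N\<in>two_three_msets. f (g N) = N"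
    proof
      fix N assume N: "N \<in> two_three_msets"
      have "image_mset (\<lambda>k. 3 * (k div 3)) (filter_mset odd N) = image_mset id (filter_mset odd N)"
        using N by (intro image_mset_cong) (auto simp: two_three_msets_def)
      moreover have "image_mset (\<lambda>k. 2 * (k div 2)) (filter_mset even N) = image_mset id (filter_mset even N)"
        by (intro image_mset_cong) auto
      ultimately show "f (g N) = N"
        using multiset_partition[of N odd]
        by (simp add: f_def g_def image_mset.compositionality comp_def)
    qed
    show "f ` (odd_msets \<times> pos_msets) \<subseteq> two_three_msets"
    proof safe
      fix M E assume "M \<in> odd_msets" "E \<in> pos_msets"
      then have "0 \<notin># M" "0 \<notin># E"
        by (auto simp: odd_msets_def pos_msets_def)
      then show "f (M, E) \<in> two_three_msets"
        unfolding f_def two_three_msets_def pos_msets_def by auto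
    qed
    show "g ` two_three_msets \<subseteq> odd_msets \<times> pos_msets"
    proof safe
      fix N M E assume N: "N \<in> two_three_msets" and "(M, E) = g N"
      then have g: "M = fst (g N)" "E = snd (g N)"
        by (metis fst_conv, metis snd_conv)
      have "odd (k div 3)" if "k \<in># N" "odd k" for k
      proof -
        have "3 dvd k"
          using N that by (auto simp: two_three_msets_def)
        then show ?thesis
          using \<open>odd k\<close> by (auto elim!: dvdE)
      qed
      then show "M \<in> odd_msets"
        unfolding g by (auto simp: g_def odd_msets_def)
      have "k div 2 \<noteq> 0" if "k \<in># N" "even k" for k
      proof -
        have "k \<noteq> 0"
          using N that by (metis (mono_tags, lifting) two_three_msets_def pos_msets_def mem_Collect_eq)
        then show ?thesis
          using \<open>even k\<close> by presburger
      qed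
      then show "E \<in> pos_msets"
        unfolding g by (force simp: g_def pos_msets_def)
    qed
  qed
  then show ?thesis
    by (rule weight_equivI) (auto simp: f_def simp flip: sum_mset_distrib_left)
qed

section \<open>Assembling the bijections\<close>

text \<open>Repeating a partition and scaling its parts by the same factor give equal sums. The
  passage from distinct to odd parts comes in between because tripled distinct parts may be even and
  would be confused with doubled ones.\<close>

lemma no_singleton_equiv_two_three:
  "weight_equiv no_singleton_msets sum_mset two_three_msets sum_mset"
proof -
  have "weight_equiv (pos_finite_sets \<times> pos_msets) (\<lambda>(D, E). 3 * \<Sum>D + 2 * sum_mset E)
     (odd_msets \<times> pos_msets) (\<lambda>(M, E). 3 * sum_mset M + 2 * sum_mset E)"
    by (intro weight_equiv_times weight_equiv_refl weight_equiv_sym[OF odd_equiv_distinct])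
  then show ?thesis
    by (rule weight_equiv_trans[OF weight_equiv_trans[OF weight_equiv_sym[OF no_singleton_equiv]]
          two_three_equiv])
qed

text \<open>The residues 1 and 5 are exactly those prime to 6, and divisibility by 2 or 3 depends
  only on \<open>k mod 6\<close>.\<close>

lemma not_cong_pm1_mod_6_iff:
  "\<not> [int k = 1] (mod 6) \<and> \<not> [int k = - 1] (mod 6) \<longleftrightarrow> 2 dvd k \<or> 3 dvd k"
proof -
  have "2 dvd k \<longleftrightarrow> 2 dvd k mod 6" "3 dvd k \<longleftrightarrow> 3 dvd k mod 6"
    by (simp_all add: dvd_mod_iff)
  moreover have "[int k = 1] (mod 6) \<longleftrightarrow> k mod 6 = 1" "[int k = - 1] (mod 6) \<longleftrightarrow> k mod 6 = 5"
    unfolding cong_def nat_int_comparison(1)[of "k mod 6"] zmod_int by simp_all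
  moreover have "k mod 6 \<in> {0, 1, 2, 3, 4, 5}"
    using mod_less_divisor[of 6 k] by auto
  ultimately show ?thesis by auto
qed

theorem theorem3p1:
  fixes n :: nat
  shows "\<exists>f. bij_betw f (designated_partitions_of n) (partition_pairs_of n)"
proof -
  have "weight_equiv (pos_msets \<times> no_singleton_msets) (\<lambda>(\<alpha>, \<gamma>). sum_mset \<alpha> + sum_mset \<gamma>)
     (pos_msets \<times> two_three_msets) (\<lambda>(\<alpha>, \<beta>). sum_mset \<alpha> + sum_mset \<beta>)"
    using weight_equiv_times[OF weight_equiv_refl no_singleton_equiv_two_three, where p = 1 and q = 1]
    by simp
  then have "weight_equiv designated_partitions (\<lambda>(M, d). sum_mset M)
     (pos_msets \<times> two_three_msets) (\<lambda>(\<alpha>, \<beta>). sum_mset \<alpha> + sum_mset \<beta>)"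
    by (rule weight_equiv_trans[OF designated_equiv_pairs])
  \<comment> \<open>Both sets of the theorem are the weight-n levels of the size-free classes; for
    pairs, the sizes a and b are determined by the components.\<close>
  moreover have "designated_partitions_of n = {x \<in> designated_partitions. (\<lambda>(M, d). sum_mset M) x = n}"
    by (auto simp: designated_partitions_of_def designated_partitions_def partitions_of_def pos_msets_def)
  moreover have "partition_pairs_of n =
      {y \<in> pos_msets \<times> two_three_msets. (\<lambda>(\<alpha>, \<beta>). sum_mset \<alpha> + sum_mset \<beta>) y = n}"
    by (auto simp: partition_pairs_of_def partitions_of_def pos_msets_def two_three_msets_def
        not_cong_pm1_mod_6_iff)
  ultimately show ?thesis
    by (simp add: weight_equiv_level)
qed

end
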